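(* For every integer $h \geq 3$ there exist a basis $C = \{c_n\}_{n=0}^{\infty}$ of order $h$ (for the nonnegative integers), consisting of nonnegative integers $c_0 < c_1 < c_2 < \cdots$, and a real number $\lambda > 0$ such that $$c_n = \lambda n^h + O\left(n^{h-1}\right).$$
   Context: A set $C$ of nonnegative integers is a basis of order $h$ (for the set $\mathbf{N}_0$ of nonnegative integers) if every nonnegative integer is the sum of exactly $h$, not necessarily distinct, elements of $C$. The notation $c_n = \lambda n^h + O(n^{h-1})$ means that there is a constant $K>0$ (which may depend on $h$ and $C$) such that $|c_n - \lambda n^h| \leq K n^{h-1}$ for all $n \geq 1$. *)

theory Defs
  imports Complex_Main
begin

definition basis_of_order :: "nat \<Rightarrow> nat set \<Rightarrow> bool" where
  "basis_of_order h C \<longleftrightarrow>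
     (\<forall>n. \<exists>xs. length xs = h \<and> set xs \<subseteq> C \<and> sum_list xs = n)"

end

theory Submission
  imports Defs "HOL-Library.Infinite_Set" "HOL-Number_Theory.Cong"
begin

text \<open>At scale \<open>G = 2\<^sup>j\<close> take pairwise coprime moduli \<open>p\<^sub>1, \<dots>, p\<^sub>h\<close> of size about \<open>G\<close>, with
  product \<open>P\<close>. By the Chinese remainder theorem the sums of the \<open>h\<close> numbers
  \<open>a\<^sub>i P / p\<^sub>i\<close> with \<open>p\<^sub>i \<le> a\<^sub>i \<le> (D + 2) p\<^sub>i\<close> cover every integer between \<open>2 h P\<close> and \<open>D P\<close>, and for a
  suitable constant \<open>D\<close> these ranges overlap for consecutive \<open>j\<close>. The summands of scale \<open>G\<close> have size
  about \<open>G\<^sup>h\<close> and lie in \<open>h\<close> progressions of difference about \<open>G\<^bsup>h-1\<^esup>\<close>. So the resulting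
  basis has a bounded number of elements between consecutive \<open>h\<close>-th powers, and it can be
  enlarged until that number is eventually constant.\<close>

section \<open>Counting functions, gaps between consecutive powers, and power growth\<close>

text \<open>Turns estimates of the counting function into estimates of the enumeration.\<close>

lemma card_below_enumerate:
  fixes S :: "nat set"
  assumes "infinite S"
  shows "card (S \<inter> {..<enumerate S n}) = n"
proof -
  have "S \<inter> {..<enumerate S n} = enumerate S ` {..<n}"
  proof (intro equalityI subsetI)
    fix x assume x: "x \<in> S \<inter> {..<enumerate S n}"
    then obtain k where k: "enumerate S k = x" using enumerate_Ex[OF assms] by blast
    with x have "k < n" using assms by auto
    with k show "x \<in> enumerate S ` {..<n}" by blast
  qed (use assms enumerate_in_set[OF assms] in auto)
  moreover have "inj_on (enumerate S) {..<n}"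
    using strict_mono_enumerate[OF assms] strict_mono_imp_inj_on inj_on_subset by blast
  ultimately show ?thesis by (simp add: card_image)
qed

text \<open>Factoring out \<open>x - y\<close> leaves \<open>h\<close> products of
  \<open>h - 1\<close> factors, each factor at most \<open>z\<close>.\<close>

lemma abs_power_diff_le:
  fixes x y z :: real
  assumes "0 \<le> x" "0 \<le> y" "x \<le> z" "y \<le> z"
  shows "\<bar>x ^ h - y ^ h\<bar> \<le> real h * \<bar>x - y\<bar> * z ^ (h - 1)"
proof (cases h)
  case (Suc n)
  have "x ^ i * y ^ (n - i) \<le> z ^ n" if "i < Suc n" for i
  proof -
    have "x ^ i * y ^ (n - i) \<le> z ^ i * z ^ (n - i)"
      using assms by (intro mult_mono power_mono) auto
    also have "\<dots> = z ^ n" using that by (simp flip: power_add)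
    finally show ?thesis .
  qed
  then have "(\<Sum>i<Suc n. x ^ i * y ^ (n - i)) \<le> (\<Sum>i<Suc n. z ^ n)"
    by (intro sum_mono) auto
  then have "(\<Sum>i<Suc n. x ^ i * y ^ (n - i)) \<le> real (Suc n) * z ^ n" by simp
  moreover have "\<bar>x ^ Suc n - y ^ Suc n\<bar> = \<bar>x - y\<bar> * (\<Sum>i<Suc n. x ^ i * y ^ (n - i))"
    unfolding diff_power_eq_sum abs_mult using assms
    by (subst abs_of_nonneg[of "sum _ _"]) (auto intro!: sum_nonneg simp del: sum.lessThan_Suc)
  ultimately show ?thesis
    using mult_left_mono[of "\<Sum>i<Suc n. x ^ i * y ^ (n - i)" "real (Suc n) * z ^ n" "\<bar>x - y\<bar>"]
    by (simp add: Suc mult_ac del: sum.lessThan_Suc)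
qed simp

lemma power_Suc_diff_le:
  fixes n :: nat
  shows "Suc n ^ h - n ^ h \<le> h * Suc n ^ (h - 1)"
proof -
  have "real (Suc n ^ h - n ^ h) \<le> real (h * Suc n ^ (h - 1))"
    using abs_power_diff_le[of "real (Suc n)" "real n" "real (Suc n)" h]
    by (simp add: of_nat_diff power_mono)
  then show ?thesis unfolding of_nat_le_iff .
qed

text \<open>Ensures that the interval starting at \<open>n ^ h\<close> has room for \<open>M\<close>
  elements as soon as \<open>n\<close> reaches \<open>M\<close>.\<close>

lemma power_Suc_diff_ge:
  fixes n :: nat
  assumes "h \<ge> 2"
  shows "n \<le> Suc n ^ h - n ^ h"
proof -
  obtain k where k: "h = Suc (Suc k)" using assms by (metis add_2_eq_Suc le_Suc_ex)
  have "n ^ h \<le> n * Suc n ^ Suc k"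
    unfolding k power_Suc[of n "Suc k"] by (intro mult_left_mono power_mono) auto
  moreover have "n \<le> Suc n ^ Suc k"
    using self_le_power[of "Suc n" "Suc k"] by simp
  moreover have "Suc n ^ h = n * Suc n ^ Suc k + Suc n ^ Suc k" by (simp add: k)
  ultimately show ?thesis by linarith
qed

text \<open>Filling every interval between consecutive \<open>h\<close>-th powers, except finitely many, up to exactly
  \<open>M\<close> elements forces the counting function to be \<open>M x\<^bsup>1/h\<^esup> + O(1)\<close>, so \<open>L = 1 / M\<^sup>h\<close>.\<close>

lemma superset_with_power_growth:
  fixes A :: "nat set"
  assumes h: "h \<ge> 2" and M: "M > 0"
    and A: "\<And>n. card (A \<inter> {n ^ h..<Suc n ^ h}) \<le> M"
  shows "\<exists>(c :: nat \<Rightarrow> nat) (L :: real).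
           strict_mono c \<and> A \<subseteq> range c \<and> L > 0 \<and>
           (\<exists>K > 0. \<forall>n \<ge> 1. \<bar>real (c n) - L * real n ^ h\<bar> \<le> K * real n ^ (h - 1))"
proof -
  define I where "I n = {n ^ h..<Suc n ^ h}" for n :: nat
  \<comment> \<open>For \<open>n < M\<close> the interval may be too short for \<open>M\<close>
    elements, so the cardinality is prescribed only from \<open>M\<close> on.\<close>
  have "\<exists>S. A \<inter> I n \<subseteq> S \<and> S \<subseteq> I n \<and> (M \<le> n \<longrightarrow> card S = M)" for n
  proof (cases "M \<le> n")
    case True
    then have "M \<le> card (I n)" using power_Suc_diff_ge[OF h, of n] by (simp add: I_def)
    then show ?thesis
      using exists_subset_between[of "A \<inter> I n" M "I n"] A[of n] by (auto simp: I_def)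
  qed auto
  then obtain S where S: "\<And>n. A \<inter> I n \<subseteq> S n" "\<And>n. S n \<subseteq> I n" "\<And>n. M \<le> n \<Longrightarrow> card (S n) = M"
    by metis
  have finS: "finite (S n)" for n using S(2)[of n] by (rule finite_subset) (simp add: I_def)
  define B where "B = (\<Union>n. S n)"
  have cell: "\<exists>n. x \<in> I n" for x
  proof -
    have "\<exists>n. x < Suc n ^ h"
    proof
      show "x < Suc x ^ h" using self_le_power[of "Suc x" h] h by simp
    qed
    then obtain n where n: "x < Suc n ^ h" "\<And>m. m < n \<Longrightarrow> \<not> x < Suc m ^ h"
      using exists_least_iff[of "\<lambda>n. x < Suc n ^ h"] by auto
    have "n ^ h \<le> x" using n(2)[of "n - 1"] h by (cases n) (auto simp: zero_power)
    with n(1) show ?thesis by (auto simp: I_def)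
  qed
  have AB: "A \<subseteq> B" using cell S(1) by (fastforce simp: B_def)
  have below: "B \<inter> {..<n ^ h} = (\<Union>k<n. S k)" for n
  proof -
    have "x < n ^ h \<longleftrightarrow> k < n" if "x \<in> S k" for x k
    proof -
      have "k ^ h \<le> x" "x < Suc k ^ h" using S(2)[of k] that by (auto simp: I_def)
      then show ?thesis
        using power_mono[of "Suc k" n h] power_mono[of n k h] by fastforce
    qed
    then show ?thesis by (fastforce simp: B_def)
  qed
  have disj: "S i \<inter> S j = {}" if "i \<noteq> j" for i j
  proof -
    have "I i \<inter> I j = {}" if "i < j" for i j
      using power_mono[of "Suc i" j h] that by (auto simp: I_def)
    then have "I i \<inter> I j = {}" using \<open>i \<noteq> j\<close> by (metis Int_commute nat_neq_iff)
    then show ?thesis using S(2) by blast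
  qed
  have count: "card (B \<inter> {..<n ^ h}) = (\<Sum>k<n. card (S k))" for n
    unfolding below using finS disj by (intro card_UN_disjoint) auto
  \<comment> \<open>Total deviation from \<open>M\<close> elements per interval; only the intervals
    below index \<open>M\<close> can contribute.\<close>
  define K0 where "K0 = (\<Sum>k<M. \<bar>real (card (S k)) - real M\<bar>)"
  have count_near: "\<bar>real (card (B \<inter> {..<n ^ h})) - real M * real n\<bar> \<le> K0" for n
  proof -
    have "\<bar>real (card (B \<inter> {..<n ^ h})) - real M * real n\<bar>
        = \<bar>\<Sum>k<n. real (card (S k)) - real M\<bar>"
      by (simp add: count sum_subtractf mult.commute)
    also have "\<dots> \<le> (\<Sum>k<n. \<bar>real (card (S k)) - real M\<bar>)" by (rule sum_abs)
    also have "\<dots> \<le> (\<Sum>k<max n M. \<bar>real (card (S k)) - real M\<bar>)"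
      by (rule sum_mono2) auto
    also have "\<dots> = K0"
      unfolding K0_def by (rule sum.mono_neutral_right) (auto simp: S(3))
    finally show ?thesis .
  qed
  have K0: "K0 \<ge> 0" by (simp add: K0_def sum_nonneg)
  have inf: "infinite B"
  proof
    assume "finite B"
    then obtain m where m: "\<And>x. x \<in> B \<Longrightarrow> x \<le> m" using finite_nat_set_iff_bounded_le by auto
    \<comment> \<open>The index is at least \<open>M\<close>, so the cell is nonempty, and exceeds
      \<open>m\<close>, so its elements lie above the supposed bound.\<close>
    have "card (S (Suc m + M)) = M" by (rule S(3)) simp
    then obtain x where x: "x \<in> S (Suc m + M)" using M by (metis card.empty ex_in_conv not_less0)
    then have "(Suc m + M) ^ h \<le> x" using S(2)[of "Suc m + M"] by (auto simp: I_def)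
    moreover have "Suc m + M \<le> (Suc m + M) ^ h" using h by (intro self_le_power) auto
    moreover have "x \<le> m" using x m by (auto simp: B_def)
    ultimately show False by linarith
  qed
  define c where "c = enumerate B"
  \<comment> \<open>If \<open>c N\<close> lies in interval \<open>n\<close>, then
    \<open>M * n\<close> and \<open>M * Suc n\<close> both differ from \<open>N\<close> by at most
    \<open>K0\<close> plus one interval's content \<open>M\<close>.\<close>
  define K1 where "K1 = K0 + real M"
  define K where "K = real h * K1 * (1 + K1) ^ (h - 1) / real M ^ h"
  have K1: "K1 > 0" using K0 M by (simp add: K1_def)
  have bound: "\<bar>real (c N) - 1 / real M ^ h * real N ^ h\<bar> \<le> K * real N ^ (h - 1)" if "N \<ge> 1" for N
  proof -
    obtain n where n: "n ^ h \<le> c N" "c N < Suc n ^ h" using cell[of "c N"] by (auto simp: I_def)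
    have N: "card (B \<inter> {..<c N}) = N" unfolding c_def by (rule card_below_enumerate[OF inf])
    have "card (B \<inter> {..<n ^ h}) \<le> N" by (subst N[symmetric], rule card_mono) (use n in auto)
    then have l: "real M * real n \<le> real N + K0" using count_near[of n] by linarith
    have "N \<le> card (B \<inter> {..<Suc n ^ h})" by (subst N[symmetric], rule card_mono) (use n in auto)
    then have u: "real N \<le> real M * real (Suc n) + K0" using count_near[of "Suc n"] by linarith
    have near: "\<bar>y ^ h - real N ^ h\<bar> \<le> real h * K1 * ((1 + K1) * real N) ^ (h - 1)"
      if "0 \<le> y" "\<bar>y - real N\<bar> \<le> K1" for y
    proof -
      \<comment> \<open>Since \<open>N\<close> is at least 1, the additive error is absorbed into a
        multiple of \<open>N\<close>, giving the bound \<open>z = (1 + K1) * N\<close> for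
        \<open>abs_power_diff_le\<close>.\<close>
      have "K1 \<le> K1 * real N" using K1 \<open>N \<ge> 1\<close> by simp
      then have "y \<le> (1 + K1) * real N" "real N \<le> (1 + K1) * real N"
        using that K1 unfolding distrib_right mult_1_left by linarith+
      then have "\<bar>y ^ h - real N ^ h\<bar> \<le> real h * \<bar>y - real N\<bar> * ((1 + K1) * real N) ^ (h - 1)"
        using that(1) by (intro abs_power_diff_le) auto
      also have "\<dots> \<le> real h * K1 * ((1 + K1) * real N) ^ (h - 1)"
        using that K1 by (intro mult_right_mono mult_left_mono) auto
      finally show ?thesis .
    qed
    \<comment> \<open>\<open>M ^ h * c N\<close> is squeezed between the \<open>h\<close>-th powers
      of \<open>M * n\<close> and \<open>M * Suc n\<close>, both close to
      \<open>N ^ h\<close>.\<close>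
    have "real (n ^ h) \<le> real (c N)" "real (c N) \<le> real (Suc n ^ h)"
      using n by (simp_all only: of_nat_le_iff)
    then have "(real M * real n) ^ h \<le> real M ^ h * real (c N)"
      "real M ^ h * real (c N) \<le> (real M * real (Suc n)) ^ h"
      unfolding power_mult_distrib of_nat_power by (auto intro: mult_left_mono)
    moreover have "\<bar>(real M * real n) ^ h - real N ^ h\<bar> \<le> real h * K1 * ((1 + K1) * real N) ^ (h - 1)"
      by (rule near) (use l u in \<open>auto simp: K1_def algebra_simps\<close>)
    moreover have "\<bar>(real M * real (Suc n)) ^ h - real N ^ h\<bar> \<le> real h * K1 * ((1 + K1) * real N) ^ (h - 1)"
      by (rule near) (use l u in \<open>auto simp: K1_def algebra_simps\<close>)
    ultimately have "\<bar>real M ^ h * real (c N) - real N ^ h\<bar> \<le> real h * K1 * ((1 + K1) * real N) ^ (h - 1)"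
      by linarith
    moreover have "\<bar>real (c N) - 1 / real M ^ h * real N ^ h\<bar>
        = \<bar>real M ^ h * real (c N) - real N ^ h\<bar> / real M ^ h"
    proof -
      have "real (c N) - 1 / real M ^ h * real N ^ h = (real M ^ h * real (c N) - real N ^ h) / real M ^ h"
        using M by (simp add: field_simps)
      then show ?thesis by simp
    qed
    ultimately have "\<bar>real (c N) - 1 / real M ^ h * real N ^ h\<bar>
        \<le> real h * K1 * ((1 + K1) * real N) ^ (h - 1) / real M ^ h"
      by (simp only: divide_right_mono zero_le_power of_nat_0_le_iff)
    then show ?thesis by (simp add: K_def power_mult_distrib mult_ac)
  qed
  have "K > 0" using K1 M h by (simp add: K_def)
  moreover have "strict_mono c" unfolding c_def by (rule strict_mono_enumerate[OF inf])
  moreover have "range c = B" unfolding c_def by (rule range_enumerate[OF inf])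
  moreover have "1 / real M ^ h > 0" using M by simp
  ultimately show ?thesis using bound AB by blast
qed

section \<open>Multiples in intervals, the Chinese remainder theorem and coprime moduli\<close>

text \<open>Division by \<open>d\<close> is injective on multiples of \<open>d\<close> and lands in
  a block of \<open>m + 1\<close> consecutive integers.\<close>

lemma card_multiples_atLeastLessThan_le:
  fixes d :: nat
  assumes "d > 0" "v - u \<le> m * d"
  shows "card {x \<in> {u..<v}. d dvd x} \<le> Suc m"
proof -
  let ?X = "{x \<in> {u..<v}. d dvd x}"
  have inj: "inj_on (\<lambda>x. x div d) ?X" by (rule inj_onI) (metis dvd_div_mult_self mem_Collect_eq)
  have "(\<lambda>x. x div d) ` ?X \<subseteq> {u div d..u div d + m}"
  proof clarsimp
    fix x assume "u \<le> x" "x < v"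
    then have "x div d \<le> (u + m * d) div d" using assms(2) by (intro div_le_mono) linarith
    with \<open>u \<le> x\<close> assms(1) show "u div d \<le> x div d \<and> x div d \<le> u div d + m"
      by (simp add: div_le_mono)
  qed
  then have "card ((\<lambda>x. x div d) ` ?X) \<le> card {u div d..u div d + m}" by (intro card_mono) auto
  then show ?thesis unfolding card_image[OF inj] by simp
qed

text \<open>Modulo \<open>p i\<close> every term but the \<open>i\<close>-th vanishes, while the
  \<open>i\<close>-th cofactor is invertible; so each \<open>x i\<close> can be solved for
  separately.\<close>

lemma residue_as_sum_of_cofactors:
  fixes p :: "'a \<Rightarrow> nat"
  assumes fin: "finite I" and pos: "\<And>i. i \<in> I \<Longrightarrow> p i > 0"
    and cop: "\<And>i j. i \<in> I \<Longrightarrow> j \<in> I \<Longrightarrow> i \<noteq> j \<Longrightarrow> coprime (p i) (p j)"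
  shows "\<exists>x. (\<forall>i\<in>I. x i < p i) \<and> [(\<Sum>i\<in>I. x i * prod p (I - {i})) = n] (mod prod p I)"
proof -
  have "\<exists>y. y < p i \<and> [y * prod p (I - {i}) = n] (mod p i)" if i: "i \<in> I" for i
  proof -
    have "coprime (prod p (I - {i})) (p i)"
      using cop i by (intro prod_coprime_left) auto
    then obtain z where "[prod p (I - {i}) * z = Suc 0] (mod p i)" using cong_solve_coprime_nat by blast
    then have "[n * (prod p (I - {i}) * z) = n * Suc 0] (mod p i)" by (rule cong_scalar_left)
    then have "[(n * z) mod p i * prod p (I - {i}) = n] (mod p i)"
      by (simp add: cong_def mod_mult_left_eq mult_ac)
    then show ?thesis using pos[OF i] by (intro exI[of _ "(n * z) mod p i"]) auto
  qed
  then obtain x where x: "\<And>i. i \<in> I \<Longrightarrow> x i < p i"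
    "\<And>i. i \<in> I \<Longrightarrow> [x i * prod p (I - {i}) = n] (mod p i)"
    by metis
  have "[(\<Sum>i\<in>I. x i * prod p (I - {i})) = n] (mod p k)" if k: "k \<in> I" for k
  proof -
    have "p k dvd (\<Sum>i\<in>I - {k}. x i * prod p (I - {i}))"
      using fin k by (intro dvd_sum dvd_mult dvd_prodI) auto
    then have "[(\<Sum>i\<in>I - {k}. x i * prod p (I - {i})) = 0] (mod p k)" by (simp add: cong_0_iff)
    from cong_add[OF x(2)[OF k] this] show ?thesis
      by (simp add: sum.remove[OF fin k])
  qed
  then have "[(\<Sum>i\<in>I. x i * prod p (I - {i})) = n] (mod prod p I)"
    using cop by (intro coprime_cong_prod_nat) auto
  with x(1) show ?thesis by blast
qed

lemma sum_of_long_progressions: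
  fixes p :: "'a \<Rightarrow> nat"
  assumes fin: "finite I" and ne: "I \<noteq> {}" and pos: "\<And>i. i \<in> I \<Longrightarrow> p i > 0"
    and cop: "\<And>i j. i \<in> I \<Longrightarrow> j \<in> I \<Longrightarrow> i \<noteq> j \<Longrightarrow> coprime (p i) (p j)"
    and n: "2 * card I * prod p I \<le> n" "n \<le> D * prod p I"
  shows "\<exists>a. (\<forall>i\<in>I. p i \<le> a i \<and> a i \<le> (D + 2) * p i) \<and> (\<Sum>i\<in>I. a i * prod p (I - {i})) = n"
proof -
  define P where "P = prod p I"
  have P: "P > 0" using pos fin by (auto simp: P_def intro!: prod_pos)
  have cof: "p i * prod p (I - {i}) = P" if "i \<in> I" for i
    using prod.remove[OF fin that, of p] by (simp add: P_def)
  \<comment> \<open>Sets aside one \<open>P\<close> per index, given back later by the summand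
    \<open>p i\<close> in \<open>a i\<close>, which secures the lower bound on
    \<open>a i\<close>.\<close>
  define m where "m = n - card I * P"
  obtain x where x: "\<And>i. i \<in> I \<Longrightarrow> x i < p i"
    and cong: "[(\<Sum>i\<in>I. x i * prod p (I - {i})) = m] (mod P)"
    using residue_as_sum_of_cofactors[of I p m] fin pos cop unfolding P_def by blast
  have "x i * prod p (I - {i}) \<le> P" if "i \<in> I" for i
    unfolding cof[OF that, symmetric] using x[OF that] by (intro mult_right_mono) auto
  then have "(\<Sum>i\<in>I. x i * prod p (I - {i})) \<le> (\<Sum>i\<in>I. P)" by (intro sum_mono)
  \<comment> \<open>This is where the factor 2 in the lower bound on \<open>n\<close> enters: the
    residue sum does not exceed \<open>m\<close>, so the quotient \<open>k\<close> is a natural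
    number.\<close>
  also have "\<dots> \<le> m" using n by (simp add: m_def P_def)
  finally obtain k where k: "m = k * P + (\<Sum>i\<in>I. x i * prod p (I - {i}))"
    using cong_sym[OF cong] by (auto simp: cong_le_nat)
  have "k * P \<le> m" using k by simp
  also have "m \<le> n" by (simp add: m_def)
  also have "n \<le> D * P" using n by (simp add: P_def)
  finally have kD: "k \<le> D" using P by simp
  obtain i0 where i0: "i0 \<in> I" using ne by blast
  \<comment> \<open>The whole surplus \<open>k * P\<close> goes into the single index
    \<open>i0\<close>, because \<open>p i0\<close> times its cofactor is \<open>P\<close>.\<close>
  define a where "a i = p i + x i + (if i = i0 then k * p i else 0)" for i
  have "(\<Sum>i\<in>I. a i * prod p (I - {i}))
      = (\<Sum>i\<in>I. p i * prod p (I - {i})) + (\<Sum>i\<in>I. x i * prod p (I - {i}))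
        + (\<Sum>i\<in>I. if i = i0 then k * (p i * prod p (I - {i})) else 0)"
    unfolding sum.distrib[symmetric] by (rule sum.cong) (auto simp: a_def algebra_simps)
  also have "(\<Sum>i\<in>I. p i * prod p (I - {i})) = card I * P" using cof by simp
  also have "(\<Sum>i\<in>I. if i = i0 then k * (p i * prod p (I - {i})) else 0) = k * P"
    using i0 fin cof[OF i0] by simp
  finally have "(\<Sum>i\<in>I. a i * prod p (I - {i})) = n"
    using k n(1) by (simp add: m_def P_def)
  moreover have "p i \<le> a i \<and> a i \<le> (D + 2) * p i" if "i \<in> I" for i
  proof -
    have "(if i = i0 then k * p i else 0) \<le> D * p i" using kD by simp
    then show ?thesis using x[OF that] by (simp add: a_def algebra_simps)
  qed
  ultimately show ?thesis by blast
qed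

text \<open>The pairwise coprime moduli come from Goedel's beta function.\<close>

lemma coprime_Suc_mult_fact:
  assumes "i \<in> {1..h}" "j \<in> {1..h}" "i \<noteq> j"
  shows "coprime (Suc (i * (fact h * m))) (Suc (j * (fact h * m)))"
proof -
  have *: "coprime (Suc (i * (fact h * m))) (Suc (j * (fact h * m)))"
    if ij: "i \<in> {1..h}" "j \<in> {1..h}" "i < j" for i j
  proof (rule ccontr)
    assume "\<not> ?thesis"
    then obtain q where q: "prime q" "q dvd Suc (i * (fact h * m))" "q dvd Suc (j * (fact h * m))"
      using prime_factor_nat[of "gcd (Suc (i * (fact h * m))) (Suc (j * (fact h * m)))"]
      by (auto simp: coprime_iff_gcd_eq_1)
    have nF: "\<not> q dvd fact h * m"
    proof
      assume "q dvd fact h * m"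
      then have "q dvd i * (fact h * m)" by simp
      with q(2) have "q dvd 1" by (metis Suc_eq_plus1 dvd_add_right_iff)
      with q(1) show False using not_prime_unit by blast
    qed
    \<comment> \<open>The difference of the moduli is \<open>(j - i) * (fact h * m)\<close>. As
      \<open>q\<close> misses the second factor, it divides \<open>j - i\<close>, so it is at most
      \<open>h\<close> and divides \<open>fact h\<close> after all.\<close>
    have "q dvd Suc (j * (fact h * m)) - Suc (i * (fact h * m))"
      using q(2,3) by (rule dvd_diff_nat[rotated])
    then have "q dvd (j - i) * (fact h * m)" by (simp add: diff_mult_distrib)
    with nF q(1) have "q dvd j - i" by (simp add: prime_dvd_mult_iff)
    then have "q \<le> h" using ij dvd_imp_le[of q "j - i"] by simp
    then have "q dvd fact h" using q(1) by (intro dvd_fact prime_ge_1_nat)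
    with nF show False by simp
  qed
  from assms(3) show ?thesis
    using *[OF assms(1,2)] *[OF assms(2,1)] by (metis coprime_commute nat_neq_iff)
qed

section \<open>The thin basis built from dyadic scales\<close>

text \<open>Bounds how many scales can meet one interval between consecutive powers. With
  \<open>j0\<close> the least member, every member satisfies
  \<open>2 ^ (j - j0) \<le> E + 1\<close>, hence \<open>j - j0 \<le> E\<close>.\<close>

lemma card_geometric_window_le:
  fixes n E :: nat
  shows "finite {j. 2 ^ j \<le> Suc n \<and> n \<le> E * 2 ^ j}"
    and "card {j. 2 ^ j \<le> Suc n \<and> n \<le> E * 2 ^ j} \<le> E + 1"
proof -
  let ?J = "{j. 2 ^ j \<le> Suc n \<and> n \<le> E * 2 ^ j}"
  have "?J \<subseteq> {j0..j0 + E}" if "j0 \<in> ?J" "\<And>j. j \<in> ?J \<Longrightarrow> j0 \<le> j" for j0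
  proof
    fix j assume j: "j \<in> ?J"
    then have le: "j0 \<le> j" using that by blast
    have "2 ^ j0 * 2 ^ (j - j0) = (2::nat) ^ j" using le by (simp flip: power_add)
    also have "\<dots> \<le> Suc n" using j by simp
    also have "\<dots> \<le> E * 2 ^ j0 + 2 ^ j0" using that(1) one_le_power[of "2::nat" j0]
      by (auto simp del: one_le_power intro: order_trans[of _ "Suc (E * 2 ^ j0)"])
    also have "\<dots> = 2 ^ j0 * (E + 1)" by simp
    finally have "2 ^ (j - j0) \<le> E + 1" by (rule mult_left_le_imp_le) simp
    with less_exp[of "j - j0"] have "j - j0 \<le> E" by linarith
    with le show "j \<in> {j0..j0 + E}" by simp
  qed
  then have "\<exists>j0. ?J \<subseteq> {j0..j0 + E}" if "?J \<noteq> {}"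
    using that exists_least_iff[of "\<lambda>j. j \<in> ?J"] by (metis (no_types, lifting) ex_in_conv not_le)
  then obtain j0 where "?J \<subseteq> {j0..j0 + E}" by blast
  then show "finite ?J" "card ?J \<le> E + 1"
    using finite_subset card_mono[of "{j0..j0 + E}" ?J] by auto
qed

lemma exists_thin_basis:
  assumes h: "h \<ge> 2"
  shows "\<exists>A M. basis_of_order h A \<and> M > 0 \<and> (\<forall>n. card (A \<inter> {n ^ h..<Suc n ^ h}) \<le> M)"
proof -
  \<comment> \<open>Here \<open>2 ^ j\<close> is the free factor \<open>m\<close> of
    \<open>coprime_Suc_mult_fact\<close>; each modulus is \<open>2 ^ j\<close> up to a factor
    depending only on \<open>h\<close>.\<close>
  define p where "p j i = Suc (i * (fact h * 2 ^ j))" for j i :: nat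
  define I where "I = {1..h}"
  define P where "P j = prod (p j) I" for j
  define d where "d j i = prod (p j) (I - {i})" for j i
  define B where "B = P 0"
  \<comment> \<open>Chosen so that \<open>2 * h * P (Suc j) \<le> D * P j\<close>: the range of
    scale \<open>j\<close> reaches the start of the next one.\<close>
  define D where "D = 2 * h * 2 ^ h"
  \<comment> \<open>Elements of scale \<open>j\<close> are at most \<open>(D + 2) * P j\<close>,
    hence at most \<open>E * (2 ^ j) ^ h\<close>.\<close>
  define E where "E = (D + 2) * B"
  \<comment> \<open>The initial segment supplies 0 and the integers before the first range. The
    bound \<open>p j i \<le> a\<close> keeps scale \<open>j\<close> from contributing below
    \<open>P j\<close>.\<close>
  define A where "A = {..2 * h * P 0} \<union>
    (\<Union>j. \<Union>i\<in>I. {a * d j i | a. p j i \<le> a \<and> a \<le> (D + 2) * p j i})"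
  have I: "finite I" "card I = h" by (simp_all add: I_def)
  have pd: "p j i * d j i = P j" if "i \<in> I" for i j
    using prod.remove[OF I(1) that, of "p j"] by (simp add: P_def d_def)
  have p_ge: "2 ^ j \<le> p j i" if "i \<in> I" for i j
  proof -
    have "1 * 2 ^ j \<le> (i * fact h) * (2::nat) ^ j"
      using that by (intro mult_right_mono) (auto simp: I_def Suc_le_eq)
    then show ?thesis unfolding p_def mult.assoc by linarith
  qed
  have "(\<Prod>i\<in>I. 2 ^ j) \<le> P j" for j
    unfolding P_def using p_ge by (intro prod_mono) auto
  then have P_ge: "(2 ^ j) ^ h \<le> P j" for j by (simp add: I)
  have d_ge: "(2 ^ j) ^ (h - 1) \<le> d j i" if "i \<in> I" for i j
  proof -
    have "(\<Prod>i\<in>I - {i}. 2 ^ j) \<le> d j i"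
      unfolding d_def using p_ge by (intro prod_mono) auto
    then show ?thesis using that by (simp add: I)
  qed
  have "P j \<le> (\<Prod>i\<in>I. 2 ^ j * p 0 i)" for j
    unfolding P_def by (intro prod_mono) (auto simp: p_def algebra_simps)
  then have P_le: "P j \<le> (2 ^ j) ^ h * B" for j by (simp add: prod.distrib I B_def P_def)
  have "P (Suc j) \<le> (\<Prod>i\<in>I. 2 * p j i)" for j
    unfolding P_def by (intro prod_mono) (auto simp: p_def)
  then have P_Suc: "P (Suc j) \<le> 2 ^ h * P j" for j by (simp add: prod.distrib I P_def)
  have "P 0 > 0" unfolding P_def by (intro prod_pos) (auto simp: p_def)
  then have E: "E \<ge> 1" by (simp add: E_def B_def)
  have basis: "basis_of_order h A"
    unfolding basis_of_order_def
  proof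
    fix n
    show "\<exists>xs. length xs = h \<and> set xs \<subseteq> A \<and> sum_list xs = n"
    proof (cases "n < 2 * h * P 0")
      case True
      then show ?thesis
        using h by (intro exI[of _ "n # replicate (h - 1) 0"]) (auto simp: A_def sum_list_replicate)
    next
      case False
      have "\<exists>j. n < 2 * h * P j"
      proof
        have "n < 2 ^ n" by (rule less_exp)
        also have "(2::nat) ^ n \<le> (2 ^ n) ^ h" using h by (intro self_le_power) auto
        also have "\<dots> \<le> P n" by (rule P_ge)
        also have "P n \<le> 2 * h * P n" using h by simp
        finally show "n < 2 * h * P n" .
      qed
      \<comment> \<open>For the least such \<open>k\<close>, the predecessor \<open>j\<close> is a
        scale whose range contains \<open>n\<close>; \<open>k\<close> is positive because
        \<open>n\<close> is past the initial segment.\<close>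
      then obtain k where k: "n < 2 * h * P k" "\<And>j. j < k \<Longrightarrow> \<not> n < 2 * h * P j"
        using exists_least_iff[of "\<lambda>j. n < 2 * h * P j"] by auto
      then obtain j where j: "k = Suc j" using False by (cases k) auto
      have lo: "2 * card I * prod (p j) I \<le> n" using k(2)[of j] j by (simp add: I P_def)
      have "n \<le> 2 * h * P (Suc j)" using k(1) j by simp
      also have "\<dots> \<le> 2 * h * (2 ^ h * P j)" by (intro mult_left_mono P_Suc) auto
      finally have hi: "n \<le> D * prod (p j) I" by (simp add: D_def P_def mult_ac)
      have "I \<noteq> {}" using h by (simp add: I_def)
      moreover have "coprime (p j i) (p j i')" if "i \<in> I" "i' \<in> I" "i \<noteq> i'" for i i'
        using that coprime_Suc_mult_fact[of i h i'] unfolding p_def I_def by blast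
      moreover have "p j i > 0" for i by (simp add: p_def)
      ultimately obtain a where a: "\<And>i. i \<in> I \<Longrightarrow> p j i \<le> a i \<and> a i \<le> (D + 2) * p j i"
        "(\<Sum>i\<in>I. a i * d j i) = n"
        using sum_of_long_progressions[OF I(1) _ _ _ lo hi] unfolding d_def by blast
      have "sum_list (map (\<lambda>i. a i * d j i) [1..<Suc h]) = n"
        using a(2) by (simp add: sum_list_distinct_conv_sum_set I_def atLeastLessThanSuc_atLeastAtMost
            del: upt_Suc)
      moreover have "set (map (\<lambda>i. a i * d j i) [1..<Suc h]) \<subseteq> A"
        using a(1) by (fastforce simp: A_def I_def)
      ultimately show ?thesis
        by (intro exI[of _ "map (\<lambda>i. a i * d j i) [1..<Suc h]"]) (simp del: upt_Suc)
    qed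
  qed
  define m where "m = h * (E + 1) ^ (h - 1)"
  \<comment> \<open>The initial segment, plus at most \<open>E + 1\<close> scales with
    \<open>h\<close> progressions each, every progression meeting the interval at most
    \<open>Suc m\<close> times.\<close>
  define M where "M = Suc (2 * h * P 0) + (E + 1) * (h * Suc m)"
  have "card (A \<inter> {n ^ h..<Suc n ^ h}) \<le> M" for n
  proof -
    define J where "J = {j. 2 ^ j \<le> Suc n \<and> n \<le> E * 2 ^ j}"
    define X where "X j i = {x \<in> {n ^ h..<Suc n ^ h}. d j i dvd x}" for j i
    have J: "finite J" "card J \<le> E + 1" unfolding J_def by (rule card_geometric_window_le)+
    have X: "card (X j i) \<le> Suc m" if "j \<in> J" "i \<in> I" for i j
      unfolding X_def
    proof (rule card_multiples_atLeastLessThan_le)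
      have dge: "(2 ^ j) ^ (h - 1) \<le> d j i" using d_ge that by simp
      moreover have "0 < (2 ^ j :: nat) ^ (h - 1)" by simp
      ultimately show "d j i > 0" by linarith
      have "n \<le> E * 2 ^ j" "(1::nat) \<le> 2 ^ j" using that(1) by (simp_all add: J_def)
      \<comment> \<open>For scales in \<open>J\<close> this compares the interval length, at most
        \<open>h * Suc n ^ (h - 1)\<close>, with the difference
        \<open>d j i \<ge> (2 ^ j) ^ (h - 1)\<close>.\<close>
      then have "Suc n \<le> (E + 1) * 2 ^ j" unfolding distrib_right mult_1_left by linarith
      then have "h * Suc n ^ (h - 1) \<le> h * ((E + 1) * 2 ^ j) ^ (h - 1)"
        by (intro mult_left_mono power_mono) auto
      also have "\<dots> = m * (2 ^ j) ^ (h - 1)" by (simp only: m_def power_mult_distrib mult.assoc)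
      also have "\<dots> \<le> m * d j i" using dge by (rule mult_left_mono) simp
      finally show "Suc n ^ h - n ^ h \<le> m * d j i" using power_Suc_diff_le[of n h] by linarith
    qed
    have "A \<inter> {n ^ h..<Suc n ^ h} \<subseteq> {..2 * h * P 0} \<union> (\<Union>j\<in>J. \<Union>i\<in>I. X j i)"
    proof
      fix x assume x: "x \<in> A \<inter> {n ^ h..<Suc n ^ h}"
      show "x \<in> {..2 * h * P 0} \<union> (\<Union>j\<in>J. \<Union>i\<in>I. X j i)"
      proof (cases "x \<le> 2 * h * P 0")
        case False
        then obtain j i a where i: "i \<in> I" and xa: "x = a * d j i"
          and a: "p j i \<le> a" "a \<le> (D + 2) * p j i"
          using x by (auto simp: A_def)
        have "(2 ^ j) ^ h \<le> p j i * d j i" using P_ge pd[OF i] by simp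
        also have "\<dots> \<le> x" unfolding xa using a(1) by (rule mult_right_mono) simp
        also have "x < Suc n ^ h" using x by simp
        finally have "2 ^ j < Suc n" by (rule power_less_imp_less_base) simp
        moreover have "n \<le> E * 2 ^ j"
        proof -
          have "n ^ h \<le> x" using x by simp
          also have "x \<le> (D + 2) * p j i * d j i" unfolding xa using a(2) by (rule mult_right_mono) simp
          also have "\<dots> = (D + 2) * P j" using pd[OF i] by (simp only: mult.assoc)
          also have "\<dots> \<le> (D + 2) * ((2 ^ j) ^ h * B)" by (intro mult_left_mono P_le) simp
          also have "\<dots> = E * (2 ^ j) ^ h" by (simp only: E_def mult_ac)
          \<comment> \<open>Weakening \<open>E\<close> to \<open>E ^ h\<close> makes the bound a
            perfect \<open>h\<close>-th power, so the root can be taken.\<close>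
          also have "\<dots> \<le> E ^ h * (2 ^ j) ^ h" using E h by (intro mult_right_mono self_le_power) auto
          finally have "n ^ h \<le> (E * 2 ^ j) ^ h" by (simp only: power_mult_distrib)
          then show ?thesis by (rule power_mono_iff[THEN iffD1, rotated 3]) (use h in auto)
        qed
        ultimately have "j \<in> J" by (simp add: J_def)
        moreover have "x \<in> X j i" using x xa by (auto simp: X_def)
        ultimately show ?thesis using i by blast
      qed simp
    qed
    then have "card (A \<inter> {n ^ h..<Suc n ^ h}) \<le> card ({..2 * h * P 0} \<union> (\<Union>j\<in>J. \<Union>i\<in>I. X j i))"
      using J I by (intro card_mono) (auto simp: X_def)
    also have "\<dots> \<le> card {..2 * h * P 0} + card (\<Union>j\<in>J. \<Union>i\<in>I. X j i)" by (rule card_Un_le)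
    also have "card (\<Union>j\<in>J. \<Union>i\<in>I. X j i) \<le> (\<Sum>j\<in>J. card (\<Union>i\<in>I. X j i))"
      by (rule card_UN_le[OF J(1)])
    also have "\<dots> \<le> (\<Sum>j\<in>J. \<Sum>i\<in>I. card (X j i))" by (intro sum_mono card_UN_le I)
    also have "\<dots> \<le> (\<Sum>j\<in>J. \<Sum>i\<in>I. Suc m)" by (intro sum_mono X)
    also have "\<dots> = card J * (h * Suc m)" by (simp add: I)
    also have "\<dots> \<le> (E + 1) * (h * Suc m)" using J(2) by (rule mult_right_mono) simp
    finally show ?thesis by (simp add: M_def)
  qed
  moreover have "M > 0" by (simp add: M_def)
  ultimately show ?thesis using basis by blast
qed

lemma basis_of_order_mono:
  "basis_of_order h A \<Longrightarrow> A \<subseteq> B \<Longrightarrow> basis_of_order h B"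
  unfolding basis_of_order_def by (meson subset_trans)

theorem theorem10:
  fixes h :: nat
  assumes "h \<ge> 3"
  shows "\<exists>(c :: nat \<Rightarrow> nat) (L :: real).
           strict_mono c \<and> basis_of_order h (range c) \<and> L > 0 \<and>
           (\<exists>K > 0. \<forall>n \<ge> 1. \<bar>real (c n) - L * real n ^ h\<bar> \<le> K * real n ^ (h - 1))"
proof -
  have h: "h \<ge> 2" using assms by simp
  obtain A M where "basis_of_order h A" "M > 0"
    "\<And>n. card (A \<inter> {n ^ h..<Suc n ^ h}) \<le> M"
    using exists_thin_basis[OF h] by blast
  with superset_with_power_growth[OF h, of M A] show ?thesis
    using basis_of_order_mono by blast
qed

end
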